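(* Let $A=(a_{i,j})$ be a $d\times n$ generator matrix, $1<d<n$, of an $[n,d,n-d+1]_q$ linear code $C$ over the finite field $\mathbb{F}_q$, and let $f_i=\sum_{j=1}^n a_{i,j}x_j$, $a_{i,j}\in\mathbb{F}_q$, $i=1,\ldots,d$. Then $\{f_1,\ldots,f_d\}$ is a linear system of parameters of $S/I$ for any monomial ideal $I$ of $S=\mathbb{F}_q[x_1,\ldots,x_n]$ of height $n-d$.
   Context: An $[n,d,\delta]_q$ linear code is a linear subspace $C\subset\mathbb{F}_q^n$ with $\dim_{\mathbb{F}_q}C=d$ and minimum distance $\delta$, where $\delta$ is the smallest number of nonzero entries of a nonzero vector of $C$. (The case $\delta=n-d+1$ is that of a maximum distance separable code.) A generator matrix of $C$ is a $d\times n$ matrix whose rows generate $C$ as a vector space. With $\mathfrak m=(x_1,\ldots,x_n)$, linear forms $f_1,\ldots,f_d\in S$ form a linear system of parameters for $S/I$ if $d=\dim(S/I)$ and $\mathrm{rad}(I,f_1,\ldots,f_d)=\mathfrak m$. *)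

theory Defs
  imports
    "HOL-Analysis.Analysis"
    "HOL-Algebra.QuotRing"
    "HOL-Algebra.Algebraic_Closure_Type"
    "HOL-Library.Poly_Mapping"
    "HOL-Library.Extended_Nat"
begin

section \<open>Linear codes\<close>

definition hamming_weight :: "'k::zero ^ 'n \<Rightarrow> nat" where
  "hamming_weight v = card {j. v $ j \<noteq> 0}"

text \<open>Only meaningful for codes containing a nonzero vector.\<close>
definition min_distance :: "('k::zero ^ 'n) set \<Rightarrow> nat" where
  "min_distance C = Min (hamming_weight ` (C - {0}))"

definition linear_code ::
  "nat \<Rightarrow> nat \<Rightarrow> nat \<Rightarrow> nat \<Rightarrow> ('k::{field,finite} ^ 'n) set \<Rightarrow> bool" where
  "linear_code q n d \<delta> C \<longleftrightarrow>
     CARD('k) = q \<and> CARD('n) = n \<and>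
     vec.subspace C \<and> vec.dim C = d \<and> min_distance C = \<delta>"

definition generator_matrix :: "'k::field ^ 'n ^ 'd \<Rightarrow> ('k ^ 'n) set \<Rightarrow> bool" where
  "generator_matrix A C \<longleftrightarrow> vec.span (rows A) = C"


section \<open>Krull dimension, height and radical\<close>

text \<open>\<^term>\<open>prime_chain R l P\<close>: the ideals \<open>P 0 \<subset> P 1 \<subset> \<dots> \<subset> P l\<close> form a strict chain of
  prime ideals of \<open>R\<close>, of length \<open>l\<close>. Values of \<open>P\<close> beyond \<open>l\<close> are irrelevant.\<close>
definition prime_chain :: "('a, 'm) ring_scheme \<Rightarrow> nat \<Rightarrow> (nat \<Rightarrow> 'a set) \<Rightarrow> bool" where
  "prime_chain R l P \<longleftrightarrow> (\<forall>i\<le>l. primeideal (P i) R) \<and> (\<forall>i<l. P i \<subset> P (Suc i))"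

text \<open>The supremum is taken in \<^typ>\<open>enat\<close>, so the zero ring gets dimension \<open>0\<close>.\<close>
definition krull_dim :: "('a, 'm) ring_scheme \<Rightarrow> enat" where
  "krull_dim R = Sup {enat l |l. \<exists>P. prime_chain R l P}"

definition prime_height :: "('a, 'm) ring_scheme \<Rightarrow> 'a set \<Rightarrow> enat" where
  "prime_height R Q = Sup {enat l |l. \<exists>P. prime_chain R l P \<and> P l = Q}"

text \<open>The unit ideal has height \<open>\<infinity>\<close>.\<close>
definition height :: "('a, 'm) ring_scheme \<Rightarrow> 'a set \<Rightarrow> enat" where
  "height R I = Inf (prime_height R ` {Q. primeideal Q R \<and> I \<subseteq> Q})"

definition radical :: "('a, 'm) ring_scheme \<Rightarrow> 'a set \<Rightarrow> 'a set" where
  "radical R I = {r \<in> carrier R. \<exists>k::nat. r [^]\<^bsub>R\<^esub> k \<in> I}"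


section \<open>Polynomial rings, monomial ideals and systems of parameters\<close>

text \<open>Multivariate polynomials with coefficients in \<^typ>\<open>'k\<close> and variables indexed by
  \<^typ>\<open>'n\<close>, as finitely supported maps from exponent vectors to coefficients.\<close>
type_synonym ('k, 'n) mpoly = "('n \<Rightarrow>\<^sub>0 nat) \<Rightarrow>\<^sub>0 'k"

abbreviation poly_ring :: "('k::field, 'n) mpoly ring" where
  "poly_ring \<equiv> ring_of_type_algebra"

definition monom :: "('n \<Rightarrow>\<^sub>0 nat) \<Rightarrow> ('k::field, 'n) mpoly" where
  "monom e = Poly_Mapping.single e 1"

definition const :: "'k::field \<Rightarrow> ('k, 'n) mpoly" where
  "const c = Poly_Mapping.single 0 c"

definition var :: "'n \<Rightarrow> ('k::field, 'n) mpoly" where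
  "var j = monom (Poly_Mapping.single j 1)"

definition max_ideal :: "('k::field, 'n) mpoly set" where
  "max_ideal = Idl\<^bsub>poly_ring\<^esub> (range var)"

definition monomial_ideal :: "('k::field, 'n) mpoly set \<Rightarrow> bool" where
  "monomial_ideal I \<longleftrightarrow> (\<exists>E. I = Idl\<^bsub>poly_ring\<^esub> (monom ` E))"

definition linear_form :: "('k::field ^ 'n) \<Rightarrow> ('k, 'n) mpoly" where
  "linear_form a = (\<Sum>j\<in>UNIV. const (a $ j) * var j)"

text \<open>The family \<open>f\<close> is indexed by a finite type, so its length is \<^term>\<open>CARD('d)\<close>.\<close>
definition linear_sop ::
  "('k::field, 'n::finite) mpoly set \<Rightarrow> ('d::finite \<Rightarrow> ('k, 'n) mpoly) \<Rightarrow> bool" where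
  "linear_sop I f \<longleftrightarrow>
     (\<forall>i. f i \<in> range linear_form) \<and>
     krull_dim (poly_ring Quot I) = enat CARD('d) \<and>
     radical poly_ring (Idl\<^bsub>poly_ring\<^esub> (I \<union> range f)) = max_ideal"

end

theory Submission
  imports Defs
begin

text \<open>
  For a set \<open>V\<close> of variables let \<open>P\<^sub>V\<close> be the prime ideal generated by \<open>V\<close>. A prime \<open>Q\<close> containing
  the monomial ideal \<open>I\<close> contains a variable of every monomial generator, so
  \<open>I \<subseteq> P\<^sub>V \<subseteq> Q\<close> for the set \<open>V\<close> of variables in \<open>Q\<close>. The height of \<open>P\<^sub>V\<close> is the size of \<open>V\<close>, hence
  \<open>V\<close> has at least \<open>n - d\<close> elements, with equality for some \<open>Q\<close>; extending chains of primes by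
  chains of ideals \<open>P\<^sub>V\<close> gives \<open>dim (S/I) = d\<close>. If \<open>Q\<close> also contains the forms \<open>f\<^sub>i\<close>, then, as a
  nonzero codeword cannot vanish in \<open>d\<close> places, the code contains a word that is a unit vector on
  the complement of \<open>V\<close> at any prescribed place; so \<open>Q\<close> contains every variable.

  All of this rests on the bound \<open>l \<le> n\<close> for the length of a chain of primes in \<open>S\<close>, which is
  proved by counting over the finite field: choosing \<open>x\<^sub>i \<in> P\<^sub>i\<^sub>+\<^sub>1 - P\<^sub>i\<close>, the polynomials in
  \<open>x\<^sub>0, \<dots>, x\<^sub>l\<^sub>-\<^sub>1\<close> of degree less than \<open>N\<close> in each are pairwise incongruent modulo \<open>P\<^sub>0\<close>. There are
  \<open>q ^ (N ^ l)\<close> of them, but their degrees in the variables of \<open>S\<close> are \<open>O(N)\<close>, which leaves room for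
  only \<open>q ^ O(N ^ n)\<close>.
\<close>

section \<open>Ideals of type-class rings\<close>

lemma type_algebra_simps [simp]:
  "carrier (ring_of_type_algebra :: 'a::comm_ring_1 ring) = UNIV"
  "x \<otimes>\<^bsub>(ring_of_type_algebra :: 'a ring)\<^esub> y = x * y"
  "x \<oplus>\<^bsub>(ring_of_type_algebra :: 'a ring)\<^esub> y = x + y"
  "\<one>\<^bsub>(ring_of_type_algebra :: 'a ring)\<^esub> = 1"
  "\<zero>\<^bsub>(ring_of_type_algebra :: 'a ring)\<^esub> = 0"
  by (simp_all add: ring_of_type_algebra_def)

lemma type_algebra_pow [simp]:
  "x [^]\<^bsub>(ring_of_type_algebra :: 'a::comm_ring_1 ring)\<^esub> (k::nat) = x ^ k"
  by (induction k) (simp_all add: nat_pow_def mult.commute)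

lemma type_algebra_a_inv [simp]:
  "\<ominus>\<^bsub>(ring_of_type_algebra :: 'a::comm_ring_1 ring)\<^esub> x = - x"
proof -
  interpret cring "ring_of_type_algebra :: 'a ring" ..
  show ?thesis using minus_equality[of "- x" x] by simp
qed

lemma ideal_type_algebra_iff:
  "ideal J (ring_of_type_algebra :: 'a::comm_ring_1 ring) \<longleftrightarrow>
     0 \<in> J \<and> (\<forall>a\<in>J. \<forall>b\<in>J. a + b \<in> J) \<and> (\<forall>a\<in>J. \<forall>r. r * a \<in> J)"
  (is "_ \<longleftrightarrow> ?rhs")
proof
  interpret cring "ring_of_type_algebra :: 'a ring" ..
  assume "ideal J (ring_of_type_algebra :: 'a ring)"
  then interpret J: ideal J "ring_of_type_algebra :: 'a ring" .
  show ?rhs using J.zero_closed J.a_closed J.I_l_closed by simp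
next
  interpret cring "ring_of_type_algebra :: 'a ring" ..
  assume rhs: ?rhs
  have "- a \<in> J" if "a \<in> J" for a using rhs that by (metis mult_minus1)
  then show "ideal J (ring_of_type_algebra :: 'a ring)"
    using rhs
    by (intro idealI subgroup.intro ring_from_type_algebra) (auto simp: mult.commute type_algebra_a_inv[unfolded a_inv_def, simplified])
qed

lemma type_algebra_idealD:
  assumes "ideal J (ring_of_type_algebra :: 'a::comm_ring_1 ring)"
  shows "0 \<in> J" and "a \<in> J \<Longrightarrow> b \<in> J \<Longrightarrow> a + b \<in> J" and "a \<in> J \<Longrightarrow> r * a \<in> J"
    and "a \<in> J \<Longrightarrow> - a \<in> J" and "a \<in> J \<Longrightarrow> b \<in> J \<Longrightarrow> a - b \<in> J"
    and "finite Y \<Longrightarrow> (\<And>x. x \<in> Y \<Longrightarrow> F x \<in> J) \<Longrightarrow> sum F Y \<in> J"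
proof -
  have J: "0 \<in> J" "\<And>a b. a \<in> J \<Longrightarrow> b \<in> J \<Longrightarrow> a + b \<in> J" "\<And>a r. a \<in> J \<Longrightarrow> r * a \<in> J"
    using assms by (simp_all add: ideal_type_algebra_iff)
  then show "0 \<in> J" "a \<in> J \<Longrightarrow> b \<in> J \<Longrightarrow> a + b \<in> J" "a \<in> J \<Longrightarrow> r * a \<in> J" by blast+
  show m: "- a \<in> J" if "a \<in> J" for a using J(3)[OF that, of "-1"] by simp
  show "a \<in> J \<Longrightarrow> b \<in> J \<Longrightarrow> a - b \<in> J" using J(2)[of a "- b"] m[of b] by simp
  show "finite Y \<Longrightarrow> (\<And>x. x \<in> Y \<Longrightarrow> F x \<in> J) \<Longrightarrow> sum F Y \<in> J"
    by (induction Y rule: finite_induct) (simp_all add: J)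
qed

lemma type_algebra_genideal:
  fixes Y :: "'a::comm_ring_1 set"
  shows "ideal (Idl\<^bsub>ring_of_type_algebra\<^esub> Y) ring_of_type_algebra"
    and "Y \<subseteq> Idl\<^bsub>ring_of_type_algebra\<^esub> Y"
    and "ideal J ring_of_type_algebra \<Longrightarrow> Y \<subseteq> J \<Longrightarrow> Idl\<^bsub>ring_of_type_algebra\<^esub> Y \<subseteq> J"
proof -
  interpret cring "ring_of_type_algebra :: 'a ring" ..
  show "ideal (Idl\<^bsub>ring_of_type_algebra\<^esub> Y) ring_of_type_algebra"
    "Y \<subseteq> Idl\<^bsub>ring_of_type_algebra\<^esub> Y"
    "ideal J ring_of_type_algebra \<Longrightarrow> Y \<subseteq> J \<Longrightarrow> Idl\<^bsub>ring_of_type_algebra\<^esub> Y \<subseteq> J"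
    using genideal_ideal genideal_self genideal_minimal by simp_all
qed

lemma primeideal_type_algebra_iff:
  "primeideal J (ring_of_type_algebra :: 'a::comm_ring_1 ring) \<longleftrightarrow>
     ideal J (ring_of_type_algebra :: 'a ring) \<and> 1 \<notin> J \<and>
     (\<forall>a b. a * b \<in> J \<longrightarrow> a \<in> J \<or> b \<in> J)"
proof (cases "ideal J (ring_of_type_algebra :: 'a ring)")
  case True
  then have "J = UNIV \<longleftrightarrow> 1 \<in> J" 
    using type_algebra_idealD(3)[OF True, of 1] by (metis UNIV_I UNIV_eq_I mult.right_neutral)
  with True show ?thesis
    by (auto simp: primeideal_def primeideal_axioms_def)
qed (simp add: primeideal_def)

text \<open>An ideal maximal among those that contain \<open>J\<close> and miss every power of
  \<open>x\<close> exists by Zorn's lemma and is prime. This is the hard half of the fact that a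
  radical is an intersection of primes.\<close>

lemma exists_primeideal_avoiding:
  fixes x :: "'a::comm_ring_1"
  assumes J: "ideal J (ring_of_type_algebra :: 'a ring)" and x: "\<And>k. x ^ k \<notin> J"
  obtains Q where "primeideal Q (ring_of_type_algebra :: 'a ring)" "J \<subseteq> Q" "x \<notin> Q"
proof -
  define F where "F = {K. ideal K (ring_of_type_algebra :: 'a ring) \<and> J \<subseteq> K \<and> (\<forall>k. x ^ k \<notin> K)}"
  have "J \<in> F" using J x by (simp add: F_def)
  have "\<Union>\<C> \<in> F" if ne: "\<C> \<noteq> {}" and ch: "subset.chain F \<C>" for \<C>
  proof -
    have F: "\<And>K. K \<in> \<C> \<Longrightarrow> K \<in> F" and lin: "\<And>K L. K \<in> \<C> \<Longrightarrow> L \<in> \<C> \<Longrightarrow> K \<subseteq> L \<or> L \<subseteq> K"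
      using ch by (auto simp: subset_chain_def)
    have idl: "ideal K (ring_of_type_algebra :: 'a ring)" if "K \<in> \<C>" for K
      using F[OF that] by (simp add: F_def)
    have add: "a + b \<in> \<Union>\<C>" if "a \<in> \<Union>\<C>" "b \<in> \<Union>\<C>" for a b
    proof -
      obtain K L where "K \<in> \<C>" "a \<in> K" "L \<in> \<C>" "b \<in> L" using \<open>a \<in> \<Union>\<C>\<close> \<open>b \<in> \<Union>\<C>\<close> by blast
      then obtain M where "M \<in> \<C>" "a \<in> M" "b \<in> M" using lin by blast
      then show ?thesis using type_algebra_idealD(2)[OF idl] by blast
    qed
    have mult: "r * a \<in> \<Union>\<C>" if "a \<in> \<Union>\<C>" for a r
      using that type_algebra_idealD(3)[OF idl] by blast
    have zero: "0 \<in> \<Union>\<C>" using ne type_algebra_idealD(1)[OF idl] by blast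
    have "ideal (\<Union>\<C>) (ring_of_type_algebra :: 'a ring)"
      unfolding ideal_type_algebra_iff using add mult zero by blast
    moreover have "J \<subseteq> \<Union>\<C>" using ne F unfolding F_def by blast
    moreover have "x ^ k \<notin> \<Union>\<C>" for k using F unfolding F_def by blast
    ultimately show ?thesis by (simp add: F_def)
  qed
  then obtain M where "M \<in> F" and max: "\<And>K. K \<in> F \<Longrightarrow> M \<subseteq> K \<Longrightarrow> K = M"
    using subset_Zorn_nonempty[of F] \<open>J \<in> F\<close> by blast
  then have M: "ideal M (ring_of_type_algebra :: 'a ring)" "J \<subseteq> M" "\<And>k. x ^ k \<notin> M"
    by (auto simp: F_def)
  note MI = type_algebra_idealD[OF M(1)]
  \<comment> \<open>For \<open>a\<close> outside \<open>M\<close> the ideal \<open>M + (a)\<close>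
    is strictly larger than \<open>M\<close>, so by maximality it contains a power of
    \<open>x\<close>.\<close>
  have pow: "\<exists>k m r. m \<in> M \<and> x ^ k = m + r * a" if "a \<notin> M" for a
  proof -
    define K where "K = {m + r * a |m r. m \<in> M}"
    have KI: "m + r * a \<in> K" if "m \<in> M" for m r using that by (auto simp: K_def)
    have zero: "0 \<in> K" using KI[OF MI(1), of 0] by simp
    have add: "b + c \<in> K" if "b \<in> K" "c \<in> K" for b c
    proof -
      obtain m r m' r' where "b = m + r * a" "c = m' + r' * a" "m \<in> M" "m' \<in> M"
        using \<open>b \<in> K\<close> \<open>c \<in> K\<close> by (auto simp: K_def)
      then show ?thesis using KI[OF MI(2), of m m' "r + r'"] by (simp add: algebra_simps)
    qed
    have mult: "s * b \<in> K" if b: "b \<in> K" for b s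
    proof -
      obtain m r where "b = m + r * a" "m \<in> M" using b by (auto simp: K_def)
      then show ?thesis using KI[OF MI(3), of m s "s * r"] by (simp add: algebra_simps)
    qed
    have "ideal K (ring_of_type_algebra :: 'a ring)"
      unfolding ideal_type_algebra_iff using zero add mult by blast
    moreover have "M \<subseteq> K" using KI[of _ 0] by auto
    moreover have "a \<in> K" using KI[OF MI(1), of 1] by simp
    ultimately have "\<exists>k. x ^ k \<in> K" using max[of K] M(2) that unfolding F_def by blast
    then show ?thesis by (auto simp: K_def)
  qed
  have "a \<in> M \<or> b \<in> M" if ab: "a * b \<in> M" for a b
  proof (rule ccontr)
    assume "\<not> (a \<in> M \<or> b \<in> M)"
    then obtain k m r l m' s where
      "m \<in> M" "x ^ k = m + r * a" "m' \<in> M" "x ^ l = m' + s * b" using pow by meson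
    moreover from this have "x ^ (k + l) = (m' + s * b) * m + ((r * a) * m' + (r * s) * (a * b))"
      by (simp add: power_add algebra_simps)
    ultimately have "x ^ (k + l) \<in> M" using ab by (simp add: MI)
    then show False using M(3) by blast
  qed
  then have "primeideal M (ring_of_type_algebra :: 'a ring)"
    unfolding primeideal_type_algebra_iff using M(1) M(3)[of 0] by simp
  then show ?thesis using that M(2) M(3)[of 1] by simp
qed

section \<open>Prime ideals of quotient rings\<close>

text \<open>Because \<open>P\<close> contains \<open>I\<close>, it is a union of cosets of
  \<open>I\<close>, and primality can be checked on representatives.\<close>

lemma (in cring) primeideal_quot_image:
  assumes I: "ideal I R" and P: "primeideal P R" and sub: "I \<subseteq> P"
  shows "primeideal ((+>) I ` P) (R Quot I)"
proof (rule primeidealI)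
  interpret I: ideal I R by fact
  interpret P: primeideal P R by fact
  interpret h: ring_hom_cring R "R Quot I" "(+>) I" by (rule I.rcos_ring_hom_cring[OF is_cring])
  show Q: "ideal ((+>) I ` P) (R Quot I)" 
    by (rule ring_ideal_imp_quot_ideal[OF I P.is_ideal])
  show "cring (R Quot I)" by (rule I.quotient_is_cring[OF is_cring])
  have carr: "carrier (R Quot I) = (+>) I ` carrier R"
    unfolding FactRing_def by (auto simp: A_RCOSETS_def'[of R I])
  have Qc: "(+>) I ` P \<subseteq> carrier (R Quot I)"
    using carr P.a_subset by blast
  have U: "\<Union> ((+>) I ` P) = P" using ideal_incl_iff[OF I P.is_ideal] sub by simp
  have mem: "I +> a \<in> (+>) I ` P \<longleftrightarrow> a \<in> P" if "a \<in> carrier R" for a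
    using canonical_proj_vimage_mem_iff[OF I Qc that] U by simp
  show "carrier (R Quot I) \<noteq> (+>) I ` P"
    using mem[of \<one>] carr P.I_notcarr P.one_imp_carrier one_closed by blast
  fix a b assume "a \<in> carrier (R Quot I)" "b \<in> carrier (R Quot I)"
    and ab: "a \<otimes>\<^bsub>R Quot I\<^esub> b \<in> (+>) I ` P"
  then obtain x y where xy: "x \<in> carrier R" "y \<in> carrier R" "a = I +> x" "b = I +> y"
    using carr by auto
  then have "I +> (x \<otimes> y) \<in> (+>) I ` P" using ab h.hom_mult[of x y] by simp
  then have "x \<otimes> y \<in> P" using mem[of "x \<otimes> y"] xy(1,2) by blast
  then show "a \<in> (+>) I ` P \<or> b \<in> (+>) I ` P" using P.I_prime xy by blast
qed

text \<open>Strictness survives because taking images is injective on ideals that contain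
  \<open>I\<close>.\<close>

lemma (in cring) prime_chain_quot_image:
  assumes I: "ideal I R" and P: "prime_chain R l P" and sub: "I \<subseteq> P 0"
  shows "prime_chain (R Quot I) l (\<lambda>i. (+>) I ` P i)"
proof -
  have prime: "primeideal (P i) R" if "i \<le> l" for i using P that by (simp add: prime_chain_def)
  have idl: "ideal (P i) R" if "i \<le> l" for i using prime[OF that] by (simp add: primeideal_def)
  have IP: "I \<subseteq> P i" if "i \<le> l" for i
    using that
  proof (induction i)
    case (Suc i) then show ?case using P unfolding prime_chain_def
      by (meson Suc_le_lessD less_imp_le psubset_imp_subset subset_trans)
  qed (use sub in simp)
  have inj: "(+>) I ` P i \<noteq> (+>) I ` P j" if "i \<le> l" "j \<le> l" "P i \<noteq> P j" for i j
    using inj_onD[OF bij_betw_imp_inj_on[OF quot_ideal_correspondence[OF I]], of "P i" "P j"]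
      that idl IP by auto
  have "P i \<subset> P (Suc i)" if "i < l" for i using P that by (simp add: prime_chain_def)
  then have "(+>) I ` P i \<subset> (+>) I ` P (Suc i)" if "i < l" for i
    using inj[of i "Suc i"] that image_mono[of "P i" "P (Suc i)"]
    by (metis Suc_leI less_imp_le psubset_eq)
  then show ?thesis
    using primeideal_quot_image[OF I prime IP] by (simp add: prime_chain_def)
qed

text \<open>Preimages of primes under the projection are prime, and its surjectivity keeps the
  inclusions strict.\<close>

lemma (in cring) prime_chain_quot_vimage:
  assumes I: "ideal I R" and P: "prime_chain (R Quot I) l P"
  shows "prime_chain R l (\<lambda>i. {r \<in> carrier R. I +> r \<in> P i})"
    and "I \<subseteq> {r \<in> carrier R. I +> r \<in> P 0}"
proof -
  interpret I: ideal I R by fact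
  interpret h: ring_hom_cring R "R Quot I" "(+>) I" by (rule I.rcos_ring_hom_cring[OF is_cring])
  have carr: "carrier (R Quot I) = (+>) I ` carrier R"
    unfolding FactRing_def by (auto simp: A_RCOSETS_def'[of R I])
  have prime: "primeideal (P i) (R Quot I)" if "i \<le> l" for i
    using P that by (simp add: prime_chain_def)
  have Pc: "P i \<subseteq> (+>) I ` carrier R" if "i \<le> l" for i
    using prime[OF that] carr additive_subgroup.a_subset 
    by (metis ideal.axioms(1) primeideal.axioms(1))
  show "prime_chain R l (\<lambda>i. {r \<in> carrier R. I +> r \<in> P i})"
    unfolding prime_chain_def
  proof (intro conjI allI impI)
    show "primeideal {r \<in> carrier R. I +> r \<in> P i} R" if "i \<le> l" for i
      by (rule h.ring.primeideal_vimage[OF is_cring prime[OF that]])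
    show "{r \<in> carrier R. I +> r \<in> P i} \<subset> {r \<in> carrier R. I +> r \<in> P (Suc i)}" if il: "i < l" for i
    proof -
      have "P i \<subset> P (Suc i)" using P il by (simp add: prime_chain_def)
      moreover from this obtain Y where "Y \<in> P (Suc i)" "Y \<notin> P i" by blast
      moreover from this obtain r where "r \<in> carrier R" "Y = I +> r"
        using Pc[of "Suc i"] Suc_leI[OF il] by blast
      ultimately show ?thesis by blast
    qed
  qed
  show "I \<subseteq> {r \<in> carrier R. I +> r \<in> P 0}"
  proof
    fix r assume "r \<in> I"
    moreover have "\<zero>\<^bsub>R Quot I\<^esub> \<in> P 0"
      using prime[of 0] by (simp add: additive_subgroup.zero_closed ideal.axioms(1) primeideal_def)
    ultimately show "r \<in> {r \<in> carrier R. I +> r \<in> P 0}"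
      using I.a_rcos_const[of r] I.Icarr[of r] unfolding FactRing_def by simp
  qed
qed

section \<open>Ideals generated by variables\<close>

abbreviation "lookup \<equiv> Poly_Mapping.lookup"

abbreviation "keys \<equiv> Poly_Mapping.keys"

text \<open>This is the ideal generated by the variables in \<open>V\<close>, encoded by supports so
  that membership is tested monomial by monomial.\<close>

definition var_ideal :: "'n set \<Rightarrow> ('k::field, 'n) mpoly set" where
  "var_ideal V = {p. \<forall>m\<in>keys p. \<exists>i\<in>V. lookup m i \<noteq> 0}"

lemma monom_mult: "monom a * monom b = monom (a + b)"
  by (simp add: monom_def mult_single)

lemma monom_in_var_ideal_iff: "monom e \<in> var_ideal V \<longleftrightarrow> (\<exists>i\<in>V. lookup e i \<noteq> 0)"
  by (simp add: monom_def var_ideal_def)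

lemma var_in_var_ideal_iff: "var i \<in> var_ideal V \<longleftrightarrow> i \<in> V"
  by (auto simp: var_def monom_in_var_ideal_iff lookup_single when_def)

lemma ideal_var_ideal: "ideal (var_ideal V) (poly_ring :: ('k::field, 'n) mpoly ring)"
proof -
  have "a + b \<in> var_ideal V" if "a \<in> var_ideal V" "b \<in> var_ideal V" for a b :: "('k, 'n) mpoly"
    using that keys_add[of a b] by (auto simp: var_ideal_def)
  moreover have "r * a \<in> var_ideal V" if "a \<in> var_ideal V" for a r :: "('k, 'n) mpoly"
    unfolding var_ideal_def
  proof clarify
    fix m assume "m \<in> keys (r * a)"
    then obtain b c where "m = b + c" "c \<in> keys a" using keys_mult[of r a] by blast
    then show "\<exists>i\<in>V. lookup m i \<noteq> 0" using that by (auto simp: var_ideal_def lookup_add)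
  qed
  moreover have "0 \<in> (var_ideal V :: ('k, 'n) mpoly set)" by (simp add: var_ideal_def)
  ultimately show ?thesis unfolding ideal_type_algebra_iff by blast
qed

lemma var_ideal_subset:
  fixes J :: "('k::field, 'n) mpoly set"
  assumes J: "ideal J poly_ring" and V: "var ` V \<subseteq> J"
  shows "var_ideal V \<subseteq> J"
proof
  fix p :: "('k, 'n) mpoly" assume p: "p \<in> var_ideal V"
  have "Poly_Mapping.single m (lookup p m) \<in> J" if m: "m \<in> keys p" for m
  proof -
    obtain i where i: "i \<in> V" "lookup m i \<noteq> 0" using p m unfolding var_ideal_def by blast
    \<comment> \<open>Subtraction of exponents truncates at zero; adding back recovers
      \<open>m\<close> because its exponent at \<open>i\<close> is positive.\<close>
    then have "m = (m - Poly_Mapping.single i 1) + Poly_Mapping.single i 1"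
      by (intro poly_mapping_eqI) (auto simp: lookup_add lookup_minus lookup_single when_def)
    then have "Poly_Mapping.single m (lookup p m)
        = Poly_Mapping.single (m - Poly_Mapping.single i 1) (lookup p m) * var i"
      by (metis monom_def mult.right_neutral mult_single var_def)
    then show ?thesis using type_algebra_idealD(3)[OF J] V i(1) by auto
  qed
  then have "(\<Sum>m\<in>keys p. Poly_Mapping.single m (lookup p m)) \<in> J"
    by (intro type_algebra_idealD(6)[OF J]) auto
  moreover have "(\<Sum>m\<in>keys p. Poly_Mapping.single m (lookup p m)) = p"
    by (rule poly_mapping_eqI) (simp add: lookup_sum lookup_single when_def in_keys_iff)
  ultimately show "p \<in> J" by simp
qed

lemma var_ideal_strict_mono:
  assumes "V \<subset> W"
  shows "var_ideal V \<subset> (var_ideal W :: ('k::field, 'n) mpoly set)"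
proof -
  obtain i where "i \<in> W" "i \<notin> V" using assms by blast
  then have "var i \<in> (var_ideal W :: ('k, 'n) mpoly set)" "var i \<notin> (var_ideal V :: ('k, 'n) mpoly set)"
    by (simp_all add: var_in_var_ideal_iff)
  moreover have "var_ideal V \<subseteq> (var_ideal W :: ('k, 'n) mpoly set)"
    using assms unfolding var_ideal_def by blast
  ultimately show ?thesis by blast
qed

lemma max_ideal_eq_var_ideal: "max_ideal = (var_ideal UNIV :: ('k::field, 'n) mpoly set)"
proof
  show "max_ideal \<subseteq> (var_ideal UNIV :: ('k, 'n) mpoly set)"
    unfolding max_ideal_def
    by (intro type_algebra_genideal(3) ideal_var_ideal) (auto simp: var_in_var_ideal_iff)
  show "(var_ideal UNIV :: ('k, 'n) mpoly set) \<subseteq> max_ideal"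
    unfolding max_ideal_def by (intro var_ideal_subset type_algebra_genideal)
qed

text \<open>The index type carries no order. Numbering it embeds exponent vectors into maps on
  \<open>nat\<close>, whose linear order is compatible with addition and so provides a monomial
  order.\<close>

lemma exists_injective_additive_to_linorder:
  obtains \<psi> :: "('n::finite \<Rightarrow>\<^sub>0 nat) \<Rightarrow> (nat \<Rightarrow>\<^sub>0 nat)"
  where "inj \<psi>" "\<And>a b. \<psi> (a + b) = \<psi> a + \<psi> b"
proof -
  obtain e :: "'n \<Rightarrow> nat" where e: "inj e"
    using finite_imp_inj_to_nat_seg[of "UNIV :: 'n set"] by auto
  define \<psi> :: "('n \<Rightarrow>\<^sub>0 nat) \<Rightarrow> (nat \<Rightarrow>\<^sub>0 nat)"
    where "\<psi> m = (\<Sum>j\<in>UNIV. Poly_Mapping.single (e j) (lookup m j))" for m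
  have "lookup (\<psi> m) (e i) = lookup m i" for m i
    by (simp add: \<psi>_def lookup_sum lookup_single when_def inj_eq[OF e])
  then have "inj \<psi>" by (metis injI poly_mapping_eqI)
  moreover have "\<psi> (a + b) = \<psi> a + \<psi> b" for a b
    by (simp add: \<psi>_def lookup_add single_add sum.distrib)
  ultimately show ?thesis by (rule that)
qed

text \<open>A leading term argument restricted to monomials free of \<open>V\<close>: if neither
  factor lies in the ideal, the product of their largest such terms does not cancel and is again
  free of \<open>V\<close>.\<close>

lemma primeideal_var_ideal: "primeideal (var_ideal V) (poly_ring :: ('k::field, 'n::finite) mpoly ring)"
  unfolding primeideal_type_algebra_iff
proof (intro conjI allI impI ideal_var_ideal)
  show "1 \<notin> (var_ideal V :: ('k, 'n) mpoly set)" by (simp add: var_ideal_def)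
  fix p q :: "('k, 'n) mpoly"
  assume pq: "p * q \<in> var_ideal V"
  define K where "K r = {m \<in> keys r. \<forall>i\<in>V. lookup m i = 0}" for r :: "('k, 'n) mpoly"
  obtain \<psi> :: "('n \<Rightarrow>\<^sub>0 nat) \<Rightarrow> (nat \<Rightarrow>\<^sub>0 nat)"
    where \<psi>: "inj \<psi>" "\<And>a b. \<psi> (a + b) = \<psi> a + \<psi> b"
    using exists_injective_additive_to_linorder by blast
  have max: "\<exists>m\<in>K r. \<forall>a\<in>K r. \<psi> a \<le> \<psi> m" if "r \<notin> var_ideal V" for r
  proof -
    have "K r \<noteq> {}" "finite (K r)" using that by (auto simp: K_def var_ideal_def)
    then have "Max (\<psi> ` K r) \<in> \<psi> ` K r" by (intro Max_in) auto
    then obtain m where "m \<in> K r" "\<psi> m = Max (\<psi> ` K r)" by (metis imageE)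
    moreover from this have "\<psi> a \<le> \<psi> m" if "a \<in> K r" for a
      using Max_ge[of "\<psi> ` K r" "\<psi> a"] \<open>finite (K r)\<close> that by simp
    ultimately show ?thesis by blast
  qed
  show "p \<in> var_ideal V \<or> q \<in> var_ideal V"
  proof (rule ccontr)
    assume "\<not> ?thesis"
    then obtain m n where m: "m \<in> K p" "\<forall>a\<in>K p. \<psi> a \<le> \<psi> m"
      and n: "n \<in> K q" "\<forall>a\<in>K q. \<psi> a \<le> \<psi> n"
      using max[of p] max[of q] by blast
    \<comment> \<open>Exponents are natural numbers, so a product free of \<open>V\<close> has
      factors free of \<open>V\<close>. Maximality of \<open>m\<close> and \<open>n\<close> then
      forces equality in both places.\<close>
    have uniq: "a = m \<and> b = n" if "a \<in> keys p" "b \<in> keys q" "m + n = a + b" for a b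
    proof -
      have "lookup a i = 0 \<and> lookup b i = 0" if "i \<in> V" for i
      proof -
        have "lookup (a + b) i = lookup (m + n) i" using \<open>m + n = a + b\<close> by simp
        then show ?thesis using m(1) n(1) that by (simp add: K_def lookup_add)
      qed
      then have ab: "\<psi> a \<le> \<psi> m" "\<psi> b \<le> \<psi> n" using that m n by (auto simp: K_def)
      have "\<psi> a + \<psi> b = \<psi> m + \<psi> n" using that(3) by (metis \<psi>(2))
      then have "\<psi> a = \<psi> m" "\<psi> b = \<psi> n" 
        using ab add_le_less_mono[of "\<psi> a" "\<psi> m" "\<psi> b" "\<psi> n"] add_less_le_mono[of "\<psi> a" "\<psi> m" "\<psi> b" "\<psi> n"]
        by (auto simp: le_less)
      then show ?thesis by (simp add: inj_eq[OF \<psi>(1)])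
    qed
    \<comment> \<open>The coefficient at \<open>m + n\<close> is a convolution sum in which
      \<open>uniq\<close> leaves a single term.\<close>
    have "lookup (p * q) (m + n) = (\<Sum>(a, b). lookup p a * lookup q b when m + n = a + b)"
      unfolding times_poly_mapping.rep_eq by (rule prod_fun_unfold_prod) simp_all
    also have "\<dots> = (\<Sum>ab. (case ab of (a, b) \<Rightarrow> lookup p a * lookup q b) when (m, n) = ab)"
      using uniq by (intro Sum_any.cong) (auto simp: when_def in_keys_iff split_def)
    also have "\<dots> = lookup p m * lookup q n" by simp
    also have "\<dots> \<noteq> 0" using m(1) n(1) by (auto simp: K_def in_keys_iff)
    finally have "m + n \<in> keys (p * q)" by (simp add: in_keys_iff)
    then show False using pq m(1) n(1) by (auto simp: var_ideal_def K_def lookup_add)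
  qed
qed

text \<open>Splitting off one variable lowers the total degree, and primality puts either that
  variable or the remaining monomial into \<open>Q\<close>. Degree zero is impossible since
  \<open>1\<close> is not in \<open>Q\<close>.\<close>

lemma primeideal_monomD:
  fixes Q :: "('k::field, 'n::finite) mpoly set"
  assumes Q: "primeideal Q poly_ring" and e: "monom e \<in> Q"
  shows "\<exists>i. lookup e i \<noteq> 0 \<and> var i \<in> Q"
  using e
proof (induction "sum (lookup e) UNIV" arbitrary: e)
  case 0
  then have "e = 0" by (intro poly_mapping_eqI) simp
  then show ?case using 0(2) Q by (simp add: monom_def primeideal_type_algebra_iff)
next
  case (Suc s)
  then obtain i where i: "lookup e i \<noteq> 0" by (metis Zero_not_Suc sum.neutral)
  define e' where "e' = e - Poly_Mapping.single i 1"
  have e: "e = e' + Poly_Mapping.single i 1"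
    using i by (intro poly_mapping_eqI) (auto simp: e'_def lookup_add lookup_minus lookup_single when_def)
  then have "monom e = monom e' * (var i :: ('k, 'n) mpoly)" by (simp add: var_def monom_mult)
  then consider "monom e' \<in> Q" | "var i \<in> Q"
    using Q Suc.prems by (auto simp: primeideal_type_algebra_iff)
  then show ?case
  proof cases
    case 1
    have "sum (lookup e) UNIV = sum (lookup e') UNIV + 1"
      by (simp add: e lookup_add sum.distrib lookup_single when_def)
    then have "s = sum (lookup e') UNIV" using Suc.hyps(2) by simp
    from Suc.hyps(1)[OF this 1] show ?thesis by (auto simp: e lookup_add)
  next
    case 2
    with i show ?thesis by blast
  qed
qed

lemma monomial_ideal_subset_primeideal:
  fixes I Q :: "('k::field, 'n::finite) mpoly set"
  assumes I: "monomial_ideal I" and Q: "primeideal Q poly_ring" and sub: "I \<subseteq> Q"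
  shows "I \<subseteq> var_ideal {i. var i \<in> Q}" and "var_ideal {i. var i \<in> Q} \<subseteq> Q"
proof -
  obtain E where E: "I = Idl\<^bsub>poly_ring\<^esub> (monom ` E)" using I by (auto simp: monomial_ideal_def)
  have "monom e \<in> var_ideal {i. var i \<in> Q}" if "e \<in> E" for e
  proof -
    have "monom e \<in> Q" using that sub E type_algebra_genideal(2)[of "monom ` E"] by blast
    then show ?thesis using primeideal_monomD[OF Q] by (auto simp: monom_in_var_ideal_iff)
  qed
  then show "I \<subseteq> var_ideal {i. var i \<in> Q}"
    unfolding E by (intro type_algebra_genideal(3) ideal_var_ideal) auto
  show "var_ideal {i. var i \<in> Q} \<subseteq> Q"
    using Q by (intro var_ideal_subset) (auto simp: primeideal_type_algebra_iff)
qed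

section \<open>Lengths of chains of primes\<close>

text \<open>Each exponent is bounded separately, so the admissible exponent vectors form a cube that
  is easy to count.\<close>

definition degree_box :: "nat \<Rightarrow> ('k::field, 'n) mpoly set" where
  "degree_box M = {p. \<forall>m\<in>keys p. \<forall>j. lookup m j \<le> M}"

text \<open>A polynomial in the box is determined by its coefficients on a cube of
  \<open>(M + 1) ^ CARD('n)\<close> exponent vectors.\<close>

lemma card_degree_box:
  fixes M :: nat
  defines "B \<equiv> (degree_box M :: ('k::{field,finite}, 'n::finite) mpoly set)"
  shows "finite B" and "card B \<le> CARD('k) ^ ((M + 1) ^ CARD('n))"
proof -
  define E where "E = {m :: 'n \<Rightarrow>\<^sub>0 nat. \<forall>j. lookup m j \<le> M}"
  let ?F = "UNIV \<rightarrow>\<^sub>E {..M} :: ('n \<Rightarrow> nat) set"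
  have F: "finite ?F" "card ?F = (M + 1) ^ CARD('n)"
    by (simp_all add: finite_PiE card_PiE)
  have inj_E: "inj_on lookup E" "lookup ` E \<subseteq> ?F"
    by (auto simp: E_def inj_on_def intro: poly_mapping_eqI)
  have E: "finite E" "card E \<le> (M + 1) ^ CARD('n)"
    using inj_on_finite[OF inj_E F(1)] card_inj_on_le[OF inj_E F(1)] F(2) by simp_all
  let ?G = "E \<rightarrow>\<^sub>E UNIV :: (('n \<Rightarrow>\<^sub>0 nat) \<Rightarrow> 'k) set"
  have G: "finite ?G" "card ?G = CARD('k) ^ card E"
    using E(1) by (simp_all add: finite_PiE card_PiE)
  have inj: "inj_on (\<lambda>p. restrict (lookup p) E) B"
  proof (rule inj_onI, rule poly_mapping_eqI)
    fix p q m
    assume pq: "p \<in> B" "q \<in> B" "restrict (lookup p) E = restrict (lookup q) E"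
    show "lookup p m = lookup q m"
    proof (cases "m \<in> E")
      case True
      then show ?thesis using pq(3) by (metis restrict_apply')
    next
      case False
      then have "m \<notin> keys p" "m \<notin> keys q"
        using pq(1,2) unfolding B_def degree_box_def E_def by blast+
      then show ?thesis by (simp add: in_keys_iff)
    qed
  qed
  have sub: "(\<lambda>p. restrict (lookup p) E) ` B \<subseteq> ?G" by auto
  show "finite B" by (rule inj_on_finite[OF inj sub G(1)])
  have "card B \<le> CARD('k) ^ card E" using card_inj_on_le[OF inj sub G(1)] G(2) by simp
  also have "\<dots> \<le> CARD('k) ^ ((M + 1) ^ CARD('n))"
    using E(2) by (intro power_increasing) (auto simp: Suc_le_eq)
  finally show "card B \<le> CARD('k) ^ ((M + 1) ^ CARD('n))" .
qed

lemma degree_box_add: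
  assumes "p \<in> degree_box a" "q \<in> degree_box a"
  shows "p + q \<in> degree_box a"
  using assms keys_add[of p q] unfolding degree_box_def by blast

lemma degree_box_mult:
  assumes "p \<in> degree_box a" "q \<in> degree_box b"
  shows "p * q \<in> degree_box (a + b)"
  unfolding degree_box_def
proof clarify
  fix m j assume "m \<in> keys (p * q)"
  then obtain c d where "m = c + d" "c \<in> keys p" "d \<in> keys q" using keys_mult[of p q] by blast
  then show "lookup m j \<le> a + b"
    using assms by (simp add: degree_box_def lookup_add add_mono)
qed

lemma degree_box_mono: "a \<le> b \<Longrightarrow> degree_box a \<subseteq> degree_box b"
  unfolding degree_box_def using order_trans by blast

lemma exists_degree_box:
  fixes p :: "('k::field, 'n::finite) mpoly"
  obtains D where "p \<in> degree_box D"
proof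
  have "lookup m j \<le> (\<Sum>m\<in>keys p. \<Sum>j\<in>UNIV. lookup m j)" if "m \<in> keys p" for m j
  proof -
    have "lookup m j \<le> (\<Sum>j\<in>UNIV. lookup m j)" by (intro member_le_sum) auto
    also have "\<dots> \<le> (\<Sum>m\<in>keys p. \<Sum>j\<in>UNIV. lookup m j)"
      using that by (intro member_le_sum[of m]) auto
    finally show ?thesis .
  qed
  then show "p \<in> degree_box (\<Sum>m\<in>keys p. \<Sum>j\<in>UNIV. lookup m j)" by (simp add: degree_box_def)
qed

section \<open>Families of polynomials incongruent modulo a prime\<close>

definition incongruent :: "'a::ab_group_add set \<Rightarrow> 'a set \<Rightarrow> bool" where
  "incongruent P T \<longleftrightarrow> (\<forall>g\<in>T. \<forall>h\<in>T. g - h \<in> P \<longrightarrow> g = h)"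

text \<open>The new family consists of the values at \<open>x\<close> of the polynomials of degree less than \<open>k\<close>
  in one variable with coefficients in \<open>T\<close>.\<close>
lemma incongruent_family_step:
  fixes P P' :: "('k::{field,finite}, 'n::finite) mpoly set"
  assumes P: "primeideal P poly_ring" and P': "ideal P' poly_ring" and "P \<subseteq> P'"
    and x: "x \<in> P'" "x \<notin> P" "x \<in> degree_box D"
    and T: "T \<subseteq> degree_box B" "incongruent P' T"
  shows "\<exists>S. S \<subseteq> degree_box (B + k * D) \<and> card S = card T ^ k \<and> incongruent P S"
proof (induction k)
  case 0
  show ?case by (rule exI[of _ "{0}"]) (simp add: incongruent_def degree_box_def)
next
  case (Suc k)
  then obtain S where S: "S \<subseteq> degree_box (B + k * D)" "card S = card T ^ k" "incongruent P S"
    by blast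
  \<comment> \<open>Horner's scheme: \<open>g\<close> supplies a new constant term, and
    \<open>h\<close>, multiplied by \<open>x\<close>, the higher terms.\<close>
  define F where "F = (\<lambda>(g, h). g + x * h)"
  have PI: "ideal P poly_ring" and prime: "\<And>a b. a * b \<in> P \<Longrightarrow> a \<in> P \<or> b \<in> P"
    using P by (auto simp: primeideal_type_algebra_iff)
  have key: "g = g' \<and> h = h'"
    if gh: "g \<in> T" "g' \<in> T" "h \<in> S" "h' \<in> S" "F (g, h) - F (g', h') \<in> P" for g g' h h'
  proof -
    have diff: "F (g, h) - F (g', h') = (g - g') + (h - h') * x" by (simp add: F_def algebra_simps)
    \<comment> \<open>Since \<open>x\<close> lies in \<open>P'\<close>, the constant terms are
      congruent modulo \<open>P'\<close> and hence equal. What remains is a multiple of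
      \<open>x\<close>, and \<open>x\<close> cancels modulo the prime \<open>P\<close>.\<close>
    have "(g - g') + (h - h') * x - (h - h') * x \<in> P'"
      using gh(5) \<open>P \<subseteq> P'\<close> type_algebra_idealD(3)[OF P' x(1)] type_algebra_idealD(5)[OF P']
      unfolding diff by blast
    then have "g = g'" using T(2) gh(1,2) by (simp add: incongruent_def)
    moreover from this have "(h - h') * x \<in> P" using gh(5) unfolding diff by simp
    then have "h - h' \<in> P" using prime x(2) by blast
    then have "h = h'" using S(3) gh(3,4) by (simp add: incongruent_def)
    ultimately show ?thesis by simp
  qed
  have zero: "0 \<in> P" by (rule type_algebra_idealD(1)[OF PI])
  have inj: "inj_on F (T \<times> S)"
  proof (rule inj_onI)
    fix u v assume "u \<in> T \<times> S" "v \<in> T \<times> S" "F u = F v"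
    then show "u = v" using key[of "fst u" "fst v" "snd u" "snd v"] zero by (auto simp: prod_eq_iff)
  qed
  have "F (g, h) \<in> degree_box (B + Suc k * D)" if gh: "g \<in> T" "h \<in> S" for g h
  proof -
    have "x * h \<in> degree_box (D + (B + k * D))" using gh(2) S(1) x(3) by (intro degree_box_mult) auto
    moreover have "g \<in> degree_box (B + Suc k * D)"
      using gh(1) T(1) degree_box_mono[of B "B + Suc k * D"] by auto
    ultimately show ?thesis by (simp add: F_def degree_box_add algebra_simps)
  qed
  then have "F ` (T \<times> S) \<subseteq> degree_box (B + Suc k * D)" by auto
  moreover have "card (F ` (T \<times> S)) = card T ^ Suc k"
    using S(2) by (simp add: card_image[OF inj] card_cartesian_product)
  moreover have "incongruent P (F ` (T \<times> S))"
    unfolding incongruent_def using key by auto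
  ultimately show ?case by blast
qed

text \<open>A family modulo \<open>P 1\<close> becomes one modulo \<open>P 0\<close> by expanding in
  powers of an element of \<open>P 1 - P 0\<close>, which raises its size to the power
  \<open>N\<close>. It is essential that \<open>D\<close> is independent of \<open>N\<close>, so
  that degrees grow only linearly.\<close>

lemma prime_chain_incongruent_family:
  fixes P :: "nat \<Rightarrow> ('k::{field,finite}, 'n::finite) mpoly set"
  assumes "prime_chain poly_ring l P"
  shows "\<exists>D. \<forall>N. \<exists>T. T \<subseteq> degree_box (D * N) \<and> card T = CARD('k) ^ (N ^ l) \<and> incongruent (P 0) T"
  using assms
proof (induction l arbitrary: P)
  case 0
  then have P: "ideal (P 0) poly_ring" "1 \<notin> P 0"
    by (auto simp: prime_chain_def primeideal_type_algebra_iff)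
  have inj: "inj (const :: 'k \<Rightarrow> ('k, 'n) mpoly)"
    by (intro injI) (metis const_def lookup_single_eq)
  \<comment> \<open>Distinct constants differ by a unit, which cannot lie in a proper ideal.\<close>
  have "c = d" if "const c - const d \<in> P 0" for c d
  proof (rule ccontr)
    assume "c \<noteq> d"
    then have "const (inverse (c - d)) * (const c - const d) = (1 :: ('k, 'n) mpoly)"
      by (simp add: const_def mult_single flip: single_diff single_one)
    then show False using type_algebra_idealD(3)[OF P(1) that] P(2) by metis
  qed
  then have "incongruent (P 0) (range const)" by (auto simp: incongruent_def)
  moreover have "range (const :: 'k \<Rightarrow> ('k, 'n) mpoly) \<subseteq> degree_box 0"
    by (auto simp: degree_box_def const_def split: if_splits)
  ultimately show ?case
    using card_image[OF inj] by (intro exI[of _ 0] allI exI[of _ "range const"]) simp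
next
  case (Suc l)
  then have chain: "prime_chain poly_ring l (\<lambda>i. P (Suc i))" by (simp add: prime_chain_def)
  from Suc.IH[OF this] obtain D where D: "\<And>N. \<exists>T. T \<subseteq> degree_box (D * N) \<and>
      card T = CARD('k) ^ (N ^ l) \<and> incongruent (P (Suc 0)) T" by blast
  have P: "primeideal (P 0) poly_ring" "primeideal (P (Suc 0)) poly_ring" "P 0 \<subset> P (Suc 0)"
    using Suc.prems by (auto simp: prime_chain_def)
  then have P1: "ideal (P (Suc 0)) poly_ring" by (simp add: primeideal_def)
  obtain x where x: "x \<in> P (Suc 0)" "x \<notin> P 0" using P(3) by blast
  obtain D' where D': "x \<in> degree_box D'" using exists_degree_box by blast
  have "\<exists>T. T \<subseteq> degree_box ((D + D') * N) \<and> card T = CARD('k) ^ (N ^ Suc l) \<and> incongruent (P 0) T" for N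
  proof -
    obtain T where T: "T \<subseteq> degree_box (D * N)" "card T = CARD('k) ^ (N ^ l)" "incongruent (P (Suc 0)) T"
      using D by blast
    \<comment> \<open>Taking \<open>k = N\<close> gives the degree bound
      \<open>D * N + N * D'\<close>, which is \<open>(D + D') * N\<close>.\<close>
    obtain S where S: "S \<subseteq> degree_box (D * N + N * D')" "card S = card T ^ N" "incongruent (P 0) S"
      using incongruent_family_step[OF P(1) P1 psubset_imp_subset[OF P(3)] x D' T(1,3)] by blast
    have "card S = CARD('k) ^ (N ^ Suc l)" using S(2) T(2) by (simp add: mult.commute flip: power_mult)
    then show ?thesis using S(1,3) by (intro exI[of _ S]) (simp add: algebra_simps)
  qed
  then show ?case by blast
qed

theorem prime_chain_length_le:
  fixes P :: "nat \<Rightarrow> ('k::{field,finite}, 'n::finite) mpoly set"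
  assumes "prime_chain poly_ring l P"
  shows "l \<le> CARD('n)"
proof (rule ccontr)
  assume "\<not> l \<le> CARD('n)"
  then have l: "Suc CARD('n) \<le> l" by simp
  obtain D where D: "\<And>N. \<exists>T. T \<subseteq> degree_box (D * N) \<and>
      card T = CARD('k) ^ (N ^ l) \<and> incongruent (P 0) T"
    using prime_chain_incongruent_family[OF assms] by blast
  \<comment> \<open>With \<open>n = CARD('n)\<close>, this \<open>N\<close> exceeds
    \<open>(D + 1) ^ n\<close>, so \<open>N ^ (n + 1)\<close> exceeds
    \<open>((D + 1) * N) ^ n\<close>, which in turn bounds \<open>(D * N + 1) ^ n\<close>.\<close>
  define N where "N = Suc ((D + 1) ^ CARD('n))"
  have "N > 0" by (simp add: N_def)
  obtain T :: "('k, 'n) mpoly set" where T: "T \<subseteq> degree_box (D * N)" "card T = CARD('k) ^ (N ^ l)"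
    using D[of N] by blast
  have "card T \<le> CARD('k) ^ ((D * N + 1) ^ CARD('n))"
    by (rule order_trans[OF card_mono[OF card_degree_box(1) T(1)] card_degree_box(2)])
  then have "CARD('k) ^ (N ^ l) \<le> CARD('k) ^ ((D * N + 1) ^ CARD('n))"
    unfolding T(2) .
  moreover have "1 < CARD('k)"
    using card_mono[of "UNIV :: 'k set" "{0, 1}"] by simp
  ultimately have le: "N ^ l \<le> (D * N + 1) ^ CARD('n)"
    using power_le_imp_le_exp by blast
  have "N * N ^ CARD('n) \<le> N ^ l"
    using power_increasing[OF l, of N] \<open>N > 0\<close> by simp
  also have "\<dots> \<le> (D * N + 1) ^ CARD('n)" by (rule le)
  also have "\<dots> \<le> ((D + 1) * N) ^ CARD('n)" 
    using \<open>N > 0\<close> by (intro power_mono) (auto simp: algebra_simps)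
  also have "\<dots> = (D + 1) ^ CARD('n) * N ^ CARD('n)" by (rule power_mult_distrib)
  finally have "N \<le> (D + 1) ^ CARD('n)" using \<open>N > 0\<close> by simp
  then show False by (simp add: N_def)
qed

section \<open>Height and dimension of monomial ideals\<close>

lemma prime_chain_Cons:
  assumes "prime_chain R l P" "primeideal Q R" "Q \<subset> P 0"
  shows "prime_chain R (Suc l) (case_nat Q P)"
  using assms unfolding prime_chain_def by (auto split: nat.split)

lemma prime_chain_snoc:
  assumes "prime_chain R l P" "primeideal Q R" "P l \<subset> Q"
  shows "prime_chain R (Suc l) (P(Suc l := Q))"
  unfolding prime_chain_def
proof (intro conjI allI impI)
  show "primeideal ((P(Suc l := Q)) i) R" if "i \<le> Suc l" for i
    using assms that by (cases "i = Suc l") (auto simp: prime_chain_def)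
  show "(P(Suc l := Q)) i \<subset> (P(Suc l := Q)) (Suc i)" if "i < Suc l" for i
    using assms that by (cases "i = l") (auto simp: prime_chain_def)
qed

text \<open>Removing the elements of \<open>V\<close> one at a time prepends ever smaller primes,
  down to the zero ideal \<open>var_ideal {}\<close>.\<close>

lemma prime_chain_extend_below:
  fixes P :: "nat \<Rightarrow> ('k::field, 'n::finite) mpoly set"
  assumes "prime_chain poly_ring l P" and "P 0 = var_ideal V"
  shows "\<exists>P'. prime_chain poly_ring (card V + l) P' \<and> P' (card V + l) = P l"
  using finite[of V] assms
proof (induction V arbitrary: l P rule: finite_induct)
  case empty
  then show ?case by auto
next
  case (insert i V)
  have "var_ideal V \<subset> P 0"
    unfolding insert.prems(2) using insert.hyps(2) by (intro var_ideal_strict_mono) blast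
  from insert.IH[OF prime_chain_Cons[OF insert.prems(1) primeideal_var_ideal this]]
  obtain P' where "prime_chain poly_ring (card V + Suc l) P'" "P' (card V + Suc l) = P l"
    by auto
  then show ?case using insert.hyps by auto
qed

text \<open>Adjoining the missing variables one at a time appends larger primes up to
  \<open>var_ideal UNIV\<close>. Writing the top by its complement \<open>W\<close> allows induction
  on the number of steps left.\<close>

lemma prime_chain_extend_above:
  fixes P :: "nat \<Rightarrow> ('k::field, 'n::finite) mpoly set"
  assumes "prime_chain poly_ring l P" and "P l = var_ideal (- W)"
  shows "\<exists>P'. prime_chain poly_ring (l + card W) P' \<and> P' 0 = P 0"
  using finite[of W] assms
proof (induction W arbitrary: l P rule: finite_induct)
  case empty
  then show ?case by auto
next
  case (insert i W)
  have "P l \<subset> var_ideal (- W)"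
    unfolding insert.prems(2) using insert.hyps(2) by (intro var_ideal_strict_mono) blast
  from insert.IH[OF prime_chain_snoc[OF insert.prems(1) primeideal_var_ideal this]]
  obtain P' where "prime_chain poly_ring (Suc l + card W) P'" "P' 0 = P 0"
    by auto
  then show ?case using insert.hyps by auto
qed

lemma prime_chain_var_ideal:
  "prime_chain (poly_ring :: ('k::field, 'n::finite) mpoly ring) 0 (\<lambda>_. var_ideal V)"
  by (simp add: prime_chain_def primeideal_var_ideal)

section \<open>Heights of ideals of variables and of the primes above them\<close>

lemma card_le_prime_height:
  fixes Q :: "('k::field, 'n::finite) mpoly set"
  assumes Q: "primeideal Q poly_ring" and sub: "var_ideal V \<subseteq> Q"
  shows "enat (card V) \<le> prime_height poly_ring Q"
proof -
  \<comment> \<open>The starting chain has length 0 or 1, according to whether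
    \<open>var_ideal V\<close> equals \<open>Q\<close>.\<close>
  obtain l P where P: "prime_chain poly_ring l P" "P 0 = var_ideal V" "P l = Q"
  proof (cases "var_ideal V = Q")
    case True
    then show ?thesis using that[OF prime_chain_var_ideal] by simp
  next
    case False
    then have "var_ideal V \<subset> Q" using sub by blast
    from prime_chain_snoc[OF prime_chain_var_ideal Q this] show ?thesis using that by auto
  qed
  obtain P' where P': "prime_chain poly_ring (card V + l) P'" "P' (card V + l) = Q"
    using prime_chain_extend_below[OF P(1,2)] P(3) by auto
  have "enat (card V + l) \<le> prime_height poly_ring Q"
    unfolding prime_height_def using P' by (intro Sup_upper) blast
  then show ?thesis by (rule order_trans[rotated]) simp
qed

lemma card_add_card_Compl: "card V + card (- V) = CARD('n)" for V :: "'n::finite set"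
  using card_Un_disjoint[of V "- V"] by (simp add: Compl_partition)

text \<open>A chain ending in \<open>var_ideal V\<close> continues upwards through the
  \<open>card (- V)\<close> other variables, and its total length is at most
  \<open>CARD('n)\<close>.\<close>

lemma prime_height_var_ideal_le:
  "prime_height (poly_ring :: ('k::{field,finite}, 'n::finite) mpoly ring) (var_ideal V) \<le> enat (card V)"
  unfolding prime_height_def
proof (rule Sup_least)
  fix h assume "h \<in> {enat l |l. \<exists>P. prime_chain (poly_ring :: ('k, 'n) mpoly ring) l P \<and> P l = var_ideal V}"
  then obtain l and P :: "nat \<Rightarrow> ('k, 'n) mpoly set"
    where P: "h = enat l" "prime_chain poly_ring l P" "P l = var_ideal (- (- V))" by auto
  obtain P' :: "nat \<Rightarrow> ('k, 'n) mpoly set" where "prime_chain poly_ring (l + card (- V)) P'"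
    using prime_chain_extend_above[OF P(2,3)] by blast
  from prime_chain_length_le[OF this] have "l + card (- V) \<le> CARD('n)" .
  moreover note card_add_card_Compl[of V]
  ultimately show "h \<le> enat (card V)" using P(1) by simp
qed

lemma height_le_card:
  fixes I :: "('k::{field,finite}, 'n::finite) mpoly set"
  assumes "I \<subseteq> var_ideal V"
  shows "height poly_ring I \<le> enat (card V)"
proof -
  have "var_ideal V \<in> {Q. primeideal Q poly_ring \<and> I \<subseteq> Q}"
    using assms primeideal_var_ideal by simp
  then have "height poly_ring I \<le> prime_height poly_ring (var_ideal V :: ('k, 'n) mpoly set)"
    unfolding height_def by (intro Inf_lower imageI)
  also have "\<dots> \<le> enat (card V)" by (rule prime_height_var_ideal_le)
  finally show ?thesis .
qed

lemma monomial_ideal_height_attained: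
  fixes I :: "('k::{field,finite}, 'n::finite) mpoly set"
  assumes I: "monomial_ideal I" and h: "height poly_ring I = enat h"
  obtains V where "I \<subseteq> var_ideal V" "card V \<le> h"
proof -
  let ?H = "prime_height poly_ring ` {Q. primeideal Q poly_ring \<and> I \<subseteq> Q}"
  \<comment> \<open>The infimum of the empty set is infinite, so a finite height is an infimum over
    a nonempty set of \<open>enat\<close> and is attained.\<close>
  have "?H \<noteq> {}" using h unfolding height_def by (metis Inf_empty enat.distinct(1) top_enat_def)
  then have "Inf ?H \<in> ?H" unfolding Inf_enat_def by (auto intro: LeastI)
  then obtain Q where Q: "primeideal Q poly_ring" "I \<subseteq> Q" "prime_height poly_ring Q = enat h"
    using h unfolding height_def by auto
  note V = monomial_ideal_subset_primeideal[OF I Q(1,2)]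
  have "card {i. var i \<in> Q} \<le> h" using card_le_prime_height[OF Q(1) V(2)] Q(3) by simp
  with V(1) show ?thesis by (rule that)
qed

text \<open>Upper bound: a chain above \<open>I\<close> extends downwards by at least
  \<open>h\<close> steps, within the total bound \<open>CARD('n)\<close>. Lower bound: the chain
  from a smallest ideal of variables over \<open>I\<close> up to \<open>var_ideal UNIV\<close>
  passes to the quotient.\<close>

lemma krull_dim_monomial_quot:
  fixes I :: "('k::{field,finite}, 'n::finite) mpoly set"
  assumes I: "monomial_ideal I" and h: "height poly_ring I = enat h"
  shows "krull_dim (poly_ring Quot I) = enat (CARD('n) - h)"
proof (rule antisym)
  interpret cring "poly_ring :: ('k, 'n) mpoly ring" ..
  have idl: "ideal I poly_ring"
    using I type_algebra_genideal(1) by (auto simp: monomial_ideal_def)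
  show "krull_dim (poly_ring Quot I) \<le> enat (CARD('n) - h)"
    unfolding krull_dim_def
  proof (rule Sup_least)
    fix s assume "s \<in> {enat l |l. \<exists>P. prime_chain (poly_ring Quot I) l P}"
    then obtain l P where s: "s = enat l" and P: "prime_chain (poly_ring Quot I) l P" by blast
    obtain R :: "nat \<Rightarrow> ('k, 'n) mpoly set" where R: "prime_chain poly_ring l R" "I \<subseteq> R 0"
      using prime_chain_quot_vimage[OF idl P] by blast
    then have R0: "primeideal (R 0) poly_ring" by (simp add: prime_chain_def)
    note V = monomial_ideal_subset_primeideal[OF I R0 R(2)]
    let ?V = "{i. var i \<in> R 0}"
    \<comment> \<open>Lowering the bottom prime to the ideal of its variables keeps the length and
      makes the chain extendable downwards.\<close>
    have "var_ideal ?V \<subset> R (Suc 0)" if "0 < l"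
      using R(1) that V(2) unfolding prime_chain_def by blast
    then have "prime_chain poly_ring l (R(0 := var_ideal ?V))"
      using R(1) primeideal_var_ideal[of ?V, where 'k='k] by (simp add: prime_chain_def)
    then obtain R' :: "nat \<Rightarrow> ('k, 'n) mpoly set" where "prime_chain poly_ring (card ?V + l) R'"
      using prime_chain_extend_below[of l "R(0 := var_ideal ?V)" ?V] by auto
    from prime_chain_length_le[OF this] have "card ?V + l \<le> CARD('n)" .
    moreover have "h \<le> card ?V" using height_le_card[OF V(1)] h by simp
    ultimately show "s \<le> enat (CARD('n) - h)" using s by simp
  qed
  obtain V where V: "I \<subseteq> var_ideal V" "card V \<le> h"
    using monomial_ideal_height_attained[OF I h] .
  have "\<exists>P :: nat \<Rightarrow> ('k, 'n) mpoly set.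
      prime_chain poly_ring (0 + card (- V)) P \<and> P 0 = var_ideal V"
    by (rule prime_chain_extend_above[OF prime_chain_var_ideal]) simp
  then obtain P :: "nat \<Rightarrow> ('k, 'n) mpoly set"
    where P: "prime_chain poly_ring (card (- V)) P" "P 0 = var_ideal V"
    unfolding add_0 by blast
  have "prime_chain (poly_ring Quot I) (card (- V)) (\<lambda>i. (+>\<^bsub>poly_ring\<^esub>) I ` P i)"
    using P V(1) by (intro prime_chain_quot_image[OF idl]) simp_all
  then have "enat (card (- V)) \<le> krull_dim (poly_ring Quot I)"
    unfolding krull_dim_def by (intro Sup_upper) blast
  moreover have "CARD('n) - h \<le> card (- V)" using V(2) card_add_card_Compl[of V] by simp
  ultimately show "enat (CARD('n) - h) \<le> krull_dim (poly_ring Quot I)"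
    by (metis enat_ord_simps(1) order_trans)
qed

section \<open>Codes and systems of parameters\<close>

text \<open>Erasing \<open>CARD('n) - d\<close> coordinates is injective on \<open>C\<close>, since
  a nonzero codeword has more nonzero entries than that. The image has dimension \<open>d\<close>
  and so fills the space of vectors on the other coordinates, unit vectors included.\<close>

lemma mds_code_unit_vector:
  fixes C :: "('k::{field,finite} ^ 'n::finite) set"
  assumes C: "linear_code q n d (CARD('n) - d + 1) C" and d: "d \<le> CARD('n)"
    and V: "CARD('n) - d \<le> card V" and j: "j \<notin> V"
  obtains c :: "'k ^ 'n" where "c \<in> C" "\<And>i. i \<notin> V \<Longrightarrow> c $ i = (if i = j then 1 else 0)"
proof -
  have sub: "vec.subspace C" and dim: "vec.dim C = d" and min: "min_distance C = CARD('n) - d + 1"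
    using C by (auto simp: linear_code_def)
  obtain U where U: "U \<subseteq> V" "card U = CARD('n) - d"
    using obtain_subset_with_card_n[OF V] by blast
  \<comment> \<open>Erased coordinates are set to zero instead of deleted, which keeps the vector
    type.\<close>
  define pr :: "'k ^ 'n \<Rightarrow> 'k ^ 'n" where "pr = (\<lambda>c. \<chi> i. if i \<in> U then 0 else c $ i)"
  have lin: "Vector_Spaces.linear (*s) (*s) pr"
    unfolding Vector_Spaces.linear_iff
    by (simp add: vec.vector_space_axioms pr_def vec_eq_iff)
  have inj: "inj_on pr C"
  proof (rule inj_onI)
    fix a b assume ab: "a \<in> C" "b \<in> C" "pr a = pr b"
    show "a = b"
    proof (rule ccontr)
      assume "a \<noteq> b"
      then have "a - b \<in> C - {0}" using ab sub by (simp add: vec.subspace_diff)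
      then have "CARD('n) - d + 1 \<le> hamming_weight (a - b)"
        unfolding min[symmetric] min_distance_def by (intro Min_le) auto
      moreover have "a $ i = b $ i" if "i \<notin> U" for i
        using arg_cong[OF ab(3), of "\<lambda>v. v $ i"] that by (simp add: pr_def)
      then have "{i. (a - b) $ i \<noteq> 0} \<subseteq> U" by auto
      then have "hamming_weight (a - b) \<le> card U"
        unfolding hamming_weight_def by (intro card_mono) auto
      ultimately show False using U(2) by simp
    qed
  qed
  define W where "W = {v :: 'k ^ 'n. \<forall>i\<in>U. v $ i = 0}"
  have W: "vec.subspace W" by (simp add: W_def vec.subspace_def)
  have "W \<subseteq> vec.span ((\<lambda>i. axis i 1) ` (- U))"
  proof
    fix v assume "v \<in> W"
    then have "v = (\<Sum>i\<in>- U. v $ i *s axis i 1)"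
      by (auto simp: W_def vec_eq_iff axis_def if_distrib sum.If_cases cong: if_cong)
    also have "\<dots> \<in> vec.span ((\<lambda>i. axis i 1) ` (- U))"
      by (intro vec.span_sum vec.span_scale vec.span_base) auto
    finally show "v \<in> vec.span ((\<lambda>i. axis i 1) ` (- U))" .
  qed
  then have "vec.dim W \<le> card ((\<lambda>i. axis i 1 :: 'k ^ 'n) ` (- U))"
    by (intro vec.dim_le_card) auto
  also have "\<dots> \<le> card (- U)" by (rule card_image_le) simp
  also have "\<dots> = d" using U(2) d card_add_card_Compl[of U] by simp
  also have "d = vec.dim (pr ` C)"
    using vec.dim_image_eq[OF lin, of C] inj sub dim by (simp add: vec.span_eq_iff[THEN iffD2])
  \<comment> \<open>The image lies in \<open>W\<close> and has at least the dimension of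
    \<open>W\<close>.\<close>
  finally have "pr ` C = W"
    using W vec.linear_subspace_image[OF lin sub]
    by (intro vec.subspace_dim_equal) (auto simp: W_def pr_def)
  moreover have "axis j 1 \<in> W" using j U(1) by (auto simp: W_def axis_def)
  ultimately obtain c :: "'k ^ 'n" where c: "c \<in> C" "pr c = axis j 1" by (metis imageE)
  have "c $ i = (if i = j then 1 else 0)" if "i \<notin> V" for i
  proof -
    have "pr c $ i = c $ i" using that U(1) by (auto simp: pr_def)
    then show ?thesis using c(2) by (simp add: axis_def)
  qed
  with c(1) show ?thesis by (rule that)
qed

text \<open>This carries membership in \<open>Q\<close> from the forms of the generator rows to the
  forms of all codewords.\<close>

lemma subspace_linear_form_in_ideal:
  fixes Q :: "('k::field, 'n::finite) mpoly set"
  assumes Q: "ideal Q poly_ring"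
  shows "vec.subspace {c. linear_form c \<in> Q}"
proof -
  have "linear_form (a + b) = (linear_form a + linear_form b :: ('k, 'n) mpoly)" for a b
    by (simp add: linear_form_def const_def single_add distrib_right sum.distrib)
  moreover have "linear_form (s *s a) = const s * (linear_form a :: ('k, 'n) mpoly)" for s a
    by (simp add: linear_form_def const_def mult_single sum_distrib_left flip: mult.assoc)
  moreover have "linear_form 0 = (0 :: ('k, 'n) mpoly)"
    by (simp add: linear_form_def const_def)
  ultimately show ?thesis
    using type_algebra_idealD[OF Q] by (simp add: vec.subspace_def)
qed

text \<open>For a variable \<open>j\<close> outside \<open>Q\<close>, choose a codeword that is the
  unit vector at \<open>j\<close> on all places outside \<open>Q\<close>. Its form is
  \<open>var j\<close> plus a combination of variables in \<open>Q\<close>, so \<open>var j\<close>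
  would lie in \<open>Q\<close>.\<close>

lemma var_ideal_UNIV_subset_primeideal:
  fixes Q :: "('k::{field,finite}, 'n::finite) mpoly set"
  assumes C: "linear_code q n d (CARD('n) - d + 1) C" "d \<le> CARD('n)"
    and Q: "ideal Q poly_ring" and V: "CARD('n) - d \<le> card {i. var i \<in> Q}"
    and forms: "\<And>c. c \<in> C \<Longrightarrow> linear_form c \<in> Q"
  shows "var_ideal UNIV \<subseteq> Q"
proof (intro var_ideal_subset[OF Q], safe)
  fix j
  show "var j \<in> Q"
  proof (rule ccontr)
    assume j: "var j \<notin> Q"
    then obtain c :: "'k ^ 'n" where c: "c \<in> C" "\<And>i. var i \<notin> Q \<Longrightarrow> c $ i = (if i = j then 1 else 0)"
      using mds_code_unit_vector[OF C V, of j] by auto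
    have "linear_form c = const (c $ j) * var j + (\<Sum>i\<in>UNIV - {j}. const (c $ i) * var i)"
      unfolding linear_form_def by (rule sum.remove) auto
    also have "const (c $ j) * var j = (var j :: ('k, 'n) mpoly)"
      using c(2)[OF j] by (simp add: const_def)
    finally have "var j = linear_form c - (\<Sum>i\<in>UNIV - {j}. const (c $ i) * var i)" by simp
    moreover have "const (c $ i) * var i \<in> Q" if "i \<in> UNIV - {j}" for i
    proof (cases "var i \<in> Q")
      case True
      then show ?thesis by (rule type_algebra_idealD(3)[OF Q])
    next
      case False
      then show ?thesis using c(2)[OF False] that type_algebra_idealD(1)[OF Q] by (simp add: const_def)
    qed
    then have "(\<Sum>i\<in>UNIV - {j}. const (c $ i) * var i) \<in> Q"
      by (intro type_algebra_idealD(6)[OF Q]) auto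
    ultimately have "var j \<in> Q"
      using type_algebra_idealD(5)[OF Q forms[OF c(1)]] by simp
    with j show False by blast
  qed
qed

theorem proposition3p11:
  fixes A :: "'k::{field,finite} ^ 'n::finite ^ 'd::finite"
    and C :: "('k ^ 'n) set"
    and f :: "'d \<Rightarrow> ('k, 'n) mpoly"
    and I :: "('k, 'n) mpoly set"
  assumes "1 < CARD('d)" and "CARD('d) < CARD('n)"
    and "linear_code CARD('k) CARD('n) CARD('d) (CARD('n) - CARD('d) + 1) C"
    and "generator_matrix A C"
    and "\<And>i. f i = (\<Sum>j\<in>UNIV. const (A $ i $ j) * var j)"
    and "monomial_ideal I"
    and "height poly_ring I = enat (CARD('n) - CARD('d))"
  shows "linear_sop I f"
proof -
  note dn = assms(2) and C = assms(3) and gen = assms(4) and I = assms(6) and h = assms(7)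
  have f: "f i = linear_form (A $ i)" for i by (simp add: assms(5) linear_form_def)
  define J where "J = Idl\<^bsub>poly_ring\<^esub> (I \<union> range f)"
  have J: "ideal J poly_ring" "I \<subseteq> J" "range f \<subseteq> J"
    using type_algebra_genideal(1,2)[of "I \<union> range f"] by (auto simp: J_def)
  \<comment> \<open>Finite height yields an ideal of variables over \<open>I\<close>; this places
    \<open>I\<close> inside the ideal of all variables.\<close>
  obtain V where V: "I \<subseteq> var_ideal V"
    using monomial_ideal_height_attained[OF I h] by blast
  have "I \<subseteq> var_ideal UNIV" using V unfolding var_ideal_def by blast
  moreover have "f i \<in> var_ideal UNIV" for i
    unfolding f linear_form_def
    by (intro type_algebra_idealD(6,3)[OF ideal_var_ideal]) (simp_all add: var_in_var_ideal_iff)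
  ultimately have JU: "J \<subseteq> var_ideal UNIV"
    unfolding J_def by (intro type_algebra_genideal(3)[OF ideal_var_ideal]) auto
  have radical: "radical poly_ring J = max_ideal"
  proof
    show "radical poly_ring J \<subseteq> max_ideal"
    proof
      fix r assume "r \<in> radical poly_ring J"
      then obtain k where "r ^ k \<in> var_ideal UNIV" using JU by (auto simp: radical_def)
      then show "r \<in> max_ideal"
        unfolding max_ideal_eq_var_ideal using primeideal_var_ideal[of "UNIV :: 'n set", where 'k='k]
        by (induction k) (auto simp: primeideal_type_algebra_iff)
    qed
    show "max_ideal \<subseteq> radical poly_ring J"
    proof (rule subsetI, rule ccontr)
      \<comment> \<open>An element outside the radical is missed by some prime \<open>Q\<close>
        above \<open>J\<close>, but every such \<open>Q\<close> turns out to contain all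
        variables.\<close>
      fix r assume r: "r \<in> max_ideal" "r \<notin> radical poly_ring J"
      then obtain Q where Q: "primeideal Q poly_ring" "J \<subseteq> Q" "r \<notin> Q"
        using exists_primeideal_avoiding[OF J(1)] by (auto simp: radical_def)
      then have QI: "ideal Q poly_ring" by (simp add: primeideal_def)
      have "rows A \<subseteq> {c. linear_form c \<in> Q}"
        using f J(3) Q(2) by (auto simp: rows_def row_def vec_lambda_eta)
      then have "C \<subseteq> {c. linear_form c \<in> Q}"
        using gen vec.span_minimal[OF _ subspace_linear_form_in_ideal[OF QI]]
        by (metis generator_matrix_def)
      \<comment> \<open>The variables in \<open>Q\<close> generate an ideal containing
        \<open>I\<close>, so their number is at least the height of \<open>I\<close>.\<close>
      moreover have "CARD('n) - CARD('d) \<le> card {i. var i \<in> Q}"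
        using height_le_card[OF monomial_ideal_subset_primeideal(1)[OF I Q(1)]] h J(2) Q(2) by auto
      ultimately have "var_ideal UNIV \<subseteq> Q"
        using dn by (intro var_ideal_UNIV_subset_primeideal[OF C _ QI]) auto
      then show False using r(1) Q(3) by (auto simp: max_ideal_eq_var_ideal)
    qed
  qed
  have "krull_dim (poly_ring Quot I) = enat CARD('d)"
    using krull_dim_monomial_quot[OF I h] dn by simp
  with radical f show ?thesis by (auto simp: linear_sop_def J_def)
qed

end
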